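(* Let $n\in\mathbb{N}$ and let $(\mathbf{x}_k)_{k\in\mathbb{N}}$ and $(\mathbf{y}_k)_{k\in\mathbb{N}}$ be sequences in $\mathbb{R}^n\setminus\{\mathbf{0}\}$ such that: (a) $\lim_{k\to+\infty}\mathbf{x}_k=\mathbf{0}$; (b) $\|\mathbf{y}_k\|=1$ for every $k\in\mathbb{N}$; (c) $\mathbf{x}_k\cdot\mathbf{y}_k\geq 0$ for every $k\in\mathbb{N}$. Then there exist a real number $a>0$ and a path $\mathbf{s}:\,]0,a[\,\to\mathbb{R}^n$ with the following properties: (i) $\mathbf{s}\in[\mathcal{C}^\infty(]0,a[)]^n$; (ii) $\lim_{t\to 0+}\mathbf{s}(t)=\mathbf{0}$; (iii) $\sup_{t\in\,]0,a[}\|\mathbf{s}(t)\|\,\|\mathbf{s}'(t)\|<+\infty$; (iv) the set $\{k\in\mathbb{N} : \|\mathbf{x}_k\|<a,\ \mathbf{s}(\|\mathbf{x}_k\|)=\mathbf{x}_k \text{ and } \mathbf{s}'(\|\mathbf{x}_k\|)=\mathbf{y}_k\}$ has infinitely many elements.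
   Context: $\mathbb{N}$ denotes the set of integers larger than zero, $\|\cdot\|$ the Euclidean norm on $\mathbb{R}^n$, and $\mathbf{x}\cdot\mathbf{y}$ the standard scalar product of $\mathbf{x},\mathbf{y}\in\mathbb{R}^n$. $]0,a[$ is the open interval from $0$ to $a$, and $[\mathcal{C}^\infty(]0,a[)]^n$ is the set of infinitely differentiable functions $]0,a[\,\to\mathbb{R}^n$; $\mathbf{s}'$ is the derivative of $\mathbf{s}$. *)

theory Defs
  imports "HOL-Analysis.Analysis"
begin

(* The value of vector_derivative is meaningful only where the function is differentiable;
   smooth_on requires this at every order before the next derivative is formed. *)
definition iterated_vector_derivative ::
    "nat \<Rightarrow> (real \<Rightarrow> 'a::real_normed_vector) \<Rightarrow> real \<Rightarrow> 'a" where
  "iterated_vector_derivative m f = ((\<lambda>g t. vector_derivative g (at t)) ^^ m) f"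

(* Meant for open S: derivatives are two-sided, so for such S the predicate depends only on
   the values of f on S. *)
definition smooth_on :: "(real \<Rightarrow> 'a::real_normed_vector) \<Rightarrow> real set \<Rightarrow> bool" where
  "smooth_on f S \<longleftrightarrow>
     (\<forall>m. \<forall>t\<in>S. iterated_vector_derivative m f differentiable (at t))"

end

theory Submission
  imports Defs
begin

text \<open>Write \<open>t\<^sub>k\<close> for \<open>norm (x k)\<close>. Hypotheses \<open>x_nz\<close> and \<open>x_lim\<close> provide a
  subsequence along which the positive numbers \<open>t\<^sub>k\<close> shrink at least by the factor \<open>4\<close>, so that
  the intervals of radius \<open>t\<^sub>k / 2\<close> around the \<open>t\<^sub>k\<close> are pairwise disjoint. The path \<open>s\<close> is the
  sum, over the subsequence, of the line \<open>x k + (t - t\<^sub>k) *\<^sub>R y k\<close> multiplied by a smooth cutoff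
  that is supported in the interval around \<open>t\<^sub>k\<close>, has value \<open>1\<close> and derivative \<open>0\<close> at \<open>t\<^sub>k\<close>, and
  is a rescaling of one fixed bump function.

  Close to any \<open>t > 0\<close> only one summand is non-zero (\<open>lacunary_neighbourhood\<close>), hence \<open>s\<close> is smooth
  on the positive axis and has the prescribed value and derivative at each \<open>t\<^sub>k\<close>. In the support of
  the \<open>k\<close>-th summand \<open>t\<close> is comparable to \<open>t\<^sub>k\<close>, and both \<open>x k\<close> and \<open>(t - t\<^sub>k) *\<^sub>R y k\<close> have size
  at most \<open>t\<^sub>k\<close>. Therefore \<open>norm (s t) \<le> 3 * t\<close>, while the factor \<open>1 / t\<^sub>k\<close> that differentiation of
  the cutoff produces is compensated, so that the derivative of \<open>s\<close> is even bounded by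
  itself (\<open>norm_nodal_path_le\<close>, \<open>nodal_path_deriv_bounded\<close>).\<close>

section \<open>Smoothness criteria\<close>

lemma iterated_vector_derivative_0 [simp]: "iterated_vector_derivative 0 f = f"
  by (simp add: iterated_vector_derivative_def)

lemma iterated_vector_derivative_Suc [simp]:
  "iterated_vector_derivative (Suc m) f =
     (\<lambda>t. vector_derivative (iterated_vector_derivative m f) (at t))"
  by (simp add: iterated_vector_derivative_def)

text \<open>A set of functions that is closed under differentiation consists of smooth functions, as all
  iterated derivatives stay in the set. As derivatives at points of the open set \<open>S\<close> are determined
  by the values on \<open>S\<close>, it suffices that \<open>f\<close> agrees on \<open>S\<close> with a member of such a set.\<close>

lemma smooth_on_if_deriv_closed:
  fixes F :: "(real \<Rightarrow> 'a::real_normed_vector) set"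
  assumes S: "open S" and "g \<in> F" and fg: "\<And>t. t \<in> S \<Longrightarrow> f t = g t"
    and closed: "\<And>h. h \<in> F \<Longrightarrow> \<exists>h'\<in>F. \<forall>t\<in>S. (h has_vector_derivative h' t) (at t)"
  shows "smooth_on f S"
proof -
  have deriv: "\<exists>h'\<in>F. \<forall>t\<in>S. (k has_vector_derivative h' t) (at t)"
    if "h \<in> F" "\<And>t. t \<in> S \<Longrightarrow> k t = h t" for h k
    using closed[OF that(1)] that(2)
    by (metis S has_vector_derivative_transform_within_open)
  have iter: "\<exists>h\<in>F. \<forall>t\<in>S. iterated_vector_derivative m f t = h t" for m
  proof (induction m)
    case 0
    then show ?case using assms by auto
  next
    case (Suc m)
    then show ?case using deriv by (metis iterated_vector_derivative_Suc vector_derivative_at)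
  qed
  show ?thesis
    unfolding smooth_on_def using iter deriv
    by (metis differentiableI_vector)
qed

lemma smooth_on_if_locally_smooth:
  assumes "\<And>t. t \<in> S \<Longrightarrow> \<exists>U. t \<in> U \<and> smooth_on f U"
  shows "smooth_on f S"
  using assms by (meson smooth_on_def)

section \<open>Functions that are flat at zero\<close>

text \<open>Admitting a polynomial factor in \<open>1 / t\<close> makes the family of flat exponentials closed under
  differentiation.\<close>

definition flat_exp :: "real poly \<Rightarrow> real \<Rightarrow> real" where
  "flat_exp p t = (if t > 0 then poly p (1 / t) * exp (- (1 / t)) else 0)"

definition flat_exp_deriv :: "real poly \<Rightarrow> real poly" where
  "flat_exp_deriv p = [:0, 0, 1:] * (p - pderiv p)"

lemma poly_times_exp_minus_tendsto_0:
  fixes p :: "real poly"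
  shows "((\<lambda>z. poly p z * exp (- z)) \<longlongrightarrow> 0) at_top"
proof -
  have "((\<lambda>z. \<Sum>i\<le>degree p. coeff p i * (z ^ i / exp z)) \<longlongrightarrow>
         (\<Sum>i\<le>degree p. coeff p i * 0)) at_top"
    by (intro tendsto_sum tendsto_mult tendsto_const tendsto_power_div_exp_0)
  then show ?thesis
    by (simp add: poly_altdef sum_distrib_right exp_minus divide_inverse mult.assoc)
qed

lemma flat_exp_tendsto_0: "(flat_exp p \<longlongrightarrow> 0) (at 0)"
proof -
  have "((\<lambda>t. poly p (inverse t) * exp (- inverse t)) \<longlongrightarrow> 0) (at_right 0)"
    by (rule filterlim_compose[OF poly_times_exp_minus_tendsto_0 filterlim_inverse_at_top_right])
  then have "(flat_exp p \<longlongrightarrow> 0) (at_right 0)"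
    by (rule Lim_transform_eventually)
      (auto simp: eventually_at_right_less flat_exp_def inverse_eq_divide
        intro: eventually_mono[OF eventually_at_right_less])
  moreover have "(flat_exp p \<longlongrightarrow> 0) (at_left 0)"
    by (rule Lim_transform_eventually[OF tendsto_const])
      (auto simp: flat_exp_def eventually_at_filter)
  ultimately show ?thesis
    by (simp add: filterlim_at_split)
qed

lemma has_real_derivative_flat_exp:
  "(flat_exp p has_real_derivative flat_exp (flat_exp_deriv p) t) (at t)"
proof -
  consider "t < 0" | "t = 0" | "t > 0" by linarith
  then show ?thesis
  proof cases
    case 1
    have "((\<lambda>t. 0) has_real_derivative 0) (at t)" by simp
    then have "(flat_exp p has_real_derivative 0) (at t)"
      by (rule has_field_derivative_transform_within_open[where S = "{..<0}"])
        (use 1 in \<open>auto simp: flat_exp_def\<close>)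
    then show ?thesis using 1 by (simp add: flat_exp_def)
  next
    case 2
    \<comment> \<open>The difference quotient at zero is again a flat exponential.\<close>
    have "(\<lambda>h. (flat_exp p h - flat_exp p 0) / (h - 0)) = flat_exp (pCons 0 p)"
      by (simp add: flat_exp_def fun_eq_iff)
    moreover have "flat_exp (flat_exp_deriv p) 0 = 0" by (simp add: flat_exp_def)
    ultimately show ?thesis
      using flat_exp_tendsto_0[of "pCons 0 p"] 2 unfolding has_field_derivative_iff by simp
  next
    case 3
    have "((\<lambda>t. poly p (1 / t) * exp (- (1 / t))) has_real_derivative
            poly (flat_exp_deriv p) (1 / t) * exp (- (1 / t))) (at t)"
      using 3
      by (auto intro!: derivative_eq_intros DERIV_chain2[OF poly_DERIV]
          simp: flat_exp_deriv_def field_simps power2_eq_square)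
    then have "(flat_exp p has_real_derivative
            poly (flat_exp_deriv p) (1 / t) * exp (- (1 / t))) (at t)"
      by (rule has_field_derivative_transform_within_open[where S = "{0<..}"])
        (use 3 in \<open>auto simp: flat_exp_def\<close>)
    then show ?thesis using 3 by (simp add: flat_exp_def)
  qed
qed

text \<open>Closing the flat exponentials under algebraic operations and under substitution gives a supply
  of smooth functions that contains bump functions.\<close>

inductive_set flat_algebra :: "(real \<Rightarrow> real) set" where
  const: "(\<lambda>t. c) \<in> flat_algebra"
| ident: "(\<lambda>t. t) \<in> flat_algebra"
| add: "f \<in> flat_algebra \<Longrightarrow> g \<in> flat_algebra \<Longrightarrow> (\<lambda>t. f t + g t) \<in> flat_algebra"
| mult: "f \<in> flat_algebra \<Longrightarrow> g \<in> flat_algebra \<Longrightarrow> (\<lambda>t. f t * g t) \<in> flat_algebra"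
| flat: "f \<in> flat_algebra \<Longrightarrow> (\<lambda>t. flat_exp p (f t)) \<in> flat_algebra"

lemma flat_algebra_deriv:
  assumes "f \<in> flat_algebra"
  shows "\<exists>f'\<in>flat_algebra. \<forall>t. (f has_real_derivative f' t) (at t)"
  using assms
proof induction
  case (const c)
  show ?case by (rule bexI[OF _ flat_algebra.const[of 0]]) auto
next
  case ident
  show ?case by (rule bexI[OF _ flat_algebra.const[of 1]]) auto
next
  case (add f g)
  then obtain f' g' where *: "f' \<in> flat_algebra" "g' \<in> flat_algebra"
    "\<And>t. (f has_real_derivative f' t) (at t)" "\<And>t. (g has_real_derivative g' t) (at t)"
    by blast
  then have "(\<lambda>t. f' t + g' t) \<in> flat_algebra" by (intro flat_algebra.add)
  then show ?case by (rule bexI[rotated]) (intro allI DERIV_add *(3,4))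
next
  case (mult f g)
  then obtain f' g' where *: "f' \<in> flat_algebra" "g' \<in> flat_algebra"
    "\<And>t. (f has_real_derivative f' t) (at t)" "\<And>t. (g has_real_derivative g' t) (at t)"
    by blast
  then have "(\<lambda>t. f' t * g t + g' t * f t) \<in> flat_algebra"
    using mult by (intro flat_algebra.intros)
  then show ?case by (rule bexI[rotated]) (intro allI DERIV_mult *(3,4))
next
  case (flat f p)
  then obtain f' where *: "f' \<in> flat_algebra" "\<And>t. (f has_real_derivative f' t) (at t)"
    by blast
  then have "(\<lambda>t. flat_exp (flat_exp_deriv p) (f t) * f' t) \<in> flat_algebra"
    using flat by (intro flat_algebra.intros)
  then show ?case by (rule bexI[rotated]) (intro allI DERIV_chain2[OF has_real_derivative_flat_exp *(2)])
qed

lemma smooth_on_flat_algebra_combination: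
  fixes u v :: "'a::real_normed_vector"
  assumes S: "open S" and "f \<in> flat_algebra" "g \<in> flat_algebra"
    and h: "\<And>t. t \<in> S \<Longrightarrow> h t = f t *\<^sub>R u + g t *\<^sub>R v"
  shows "smooth_on h S"
proof (rule smooth_on_if_deriv_closed[OF S])
  let ?F = "{(\<lambda>t. f t *\<^sub>R u + g t *\<^sub>R v) | f g. f \<in> flat_algebra \<and> g \<in> flat_algebra}"
  show "(\<lambda>t. f t *\<^sub>R u + g t *\<^sub>R v) \<in> ?F" using assms by blast
  show "h t = f t *\<^sub>R u + g t *\<^sub>R v" if "t \<in> S" for t using h that .
  fix k assume "k \<in> ?F"
  then obtain f g where k: "k = (\<lambda>t. f t *\<^sub>R u + g t *\<^sub>R v)"
    and fg: "f \<in> flat_algebra" "g \<in> flat_algebra" by blast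
  obtain f' g' where *: "f' \<in> flat_algebra" "g' \<in> flat_algebra"
    "\<And>t. (f has_real_derivative f' t) (at t)" "\<And>t. (g has_real_derivative g' t) (at t)"
    using flat_algebra_deriv fg by meson
  have "(k has_vector_derivative f' t *\<^sub>R u + g' t *\<^sub>R v) (at t)" for t
    unfolding k using *(3,4)[of t]
    by (auto intro!: derivative_eq_intros)
  then show "\<exists>k'\<in>?F. \<forall>t\<in>S. (k has_vector_derivative k' t) (at t)"
    using *(1,2) by (intro bexI[of _ "\<lambda>t. f' t *\<^sub>R u + g' t *\<^sub>R v"]) auto
qed

section \<open>A line cut off around one parameter\<close>

text \<open>The quadratic polynomial is positive exactly at distance less than \<open>1/2\<close> from \<open>1\<close>, and its
  maximum, attained at \<open>1\<close>, is \<open>1\<close>; the factor \<open>exp 1\<close> normalises the value of \<open>bump\<close> there.\<close>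

definition bump :: "real \<Rightarrow> real" where
  "bump u = exp 1 * flat_exp 1 (1 - 4 * (u - 1)\<^sup>2)"

definition bump_deriv :: "real \<Rightarrow> real" where
  "bump_deriv u = exp 1 * (flat_exp (flat_exp_deriv 1) (1 - 4 * (u - 1)\<^sup>2) * (- 8 * (u - 1)))"

lemma has_real_derivative_bump: "(bump has_real_derivative bump_deriv u) (at u)"
  unfolding bump_def[abs_def] bump_deriv_def
  by (rule DERIV_cmult, rule DERIV_chain2[OF has_real_derivative_flat_exp])
    (auto intro!: derivative_eq_intros)

lemma bump_at_1: "bump 1 = 1" "bump_deriv 1 = 0"
  by (auto simp: bump_def bump_deriv_def flat_exp_def exp_minus)

lemma bump_outside:
  assumes "\<bar>u - 1\<bar> \<ge> 1 / 2"
  shows "bump u = 0" "bump_deriv u = 0"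
proof -
  have "(1 / 2)\<^sup>2 \<le> \<bar>u - 1\<bar>\<^sup>2" using assms by (intro power_mono) auto
  then have "1 - 4 * (u - 1)\<^sup>2 \<le> 0" by (simp add: power2_eq_square)
  then show "bump u = 0" "bump_deriv u = 0" by (auto simp: bump_def bump_deriv_def flat_exp_def)
qed

lemma bump_bounds: "0 \<le> bump u" "bump u \<le> 1"
proof -
  have "exp 1 * exp (- (1 / w)) \<le> 1" if "w > 0" "w \<le> 1" for w :: real
    using that by (simp add: exp_add[symmetric] field_simps)
  then show "0 \<le> bump u" "bump u \<le> 1" by (auto simp: bump_def flat_exp_def)
qed

lemma bump_deriv_bounded: obtains M where "M \<ge> 0" "\<And>u. \<bar>bump_deriv u\<bar> \<le> M"
proof -
  have "continuous_on UNIV (flat_exp p)" for p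
    by (rule DERIV_continuous_on) (rule DERIV_subset[OF has_real_derivative_flat_exp subset_UNIV])
  then have "continuous_on {0..2} (\<lambda>u. flat_exp p (1 - 4 * (u - 1)\<^sup>2))" for p
    by (rule continuous_on_compose2) (auto intro!: continuous_intros)
  then have "continuous_on {0..2} bump_deriv"
    unfolding bump_deriv_def[abs_def]
    by (intro continuous_on_mult continuous_on_const continuous_on_diff continuous_on_id)
  then have "bounded (bump_deriv ` {0..2})"
    by (intro compact_imp_bounded compact_continuous_image) auto
  then obtain M where M: "M > 0" "\<And>u. u \<in> {0..2} \<Longrightarrow> \<bar>bump_deriv u\<bar> \<le> M"
    by (auto simp: bounded_pos)
  have "\<bar>bump_deriv u\<bar> \<le> M" for u
  proof (cases "\<bar>u - 1\<bar> \<ge> 1 / 2")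
    case True
    then show ?thesis using M(1) bump_outside by simp
  next
    case False
    then have "u \<in> {0..2}" by (auto simp: abs_if split: if_splits)
    then show ?thesis by (rule M(2))
  qed
  then show ?thesis using that M(1) by (meson less_imp_le)
qed

text \<open>A path that runs through \<open>p\<close> with velocity \<open>v\<close> at time \<open>r\<close>, at the scale \<open>r\<close>.\<close>

definition nodal_path :: "real \<Rightarrow> 'a::real_normed_vector \<Rightarrow> 'a \<Rightarrow> real \<Rightarrow> 'a" where
  "nodal_path r p v t = bump (t / r) *\<^sub>R (p + (t - r) *\<^sub>R v)"

definition nodal_path_deriv :: "real \<Rightarrow> 'a::real_normed_vector \<Rightarrow> 'a \<Rightarrow> real \<Rightarrow> 'a" where
  "nodal_path_deriv r p v t =
     (bump_deriv (t / r) / r) *\<^sub>R (p + (t - r) *\<^sub>R v) + bump (t / r) *\<^sub>R v"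

lemma has_vector_derivative_nodal_path:
  "(nodal_path r p v has_vector_derivative nodal_path_deriv r p v t) (at t)"
proof -
  have "((\<lambda>t. bump (t / r)) has_real_derivative bump_deriv (t / r) / r) (at t)"
    using DERIV_chain2[OF has_real_derivative_bump DERIV_cdivide[OF DERIV_ident], of r t] by simp
  moreover have "((\<lambda>t. p + (t - r) *\<^sub>R v) has_vector_derivative v) (at t)"
    by (auto intro!: derivative_eq_intros)
  ultimately show ?thesis
    unfolding nodal_path_def[abs_def] nodal_path_deriv_def
    by (auto intro!: derivative_eq_intros)
qed

lemma nodal_path_at_node:
  assumes "r \<noteq> 0"
  shows "nodal_path r p v r = p" "nodal_path_deriv r p v r = v"
  using assms by (auto simp: nodal_path_def nodal_path_deriv_def bump_at_1)

lemma bump_rescaled_outside: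
  assumes "r > 0" "\<bar>t - r\<bar> \<ge> r / 2"
  shows "bump (t / r) = 0" "bump_deriv (t / r) = 0"
proof -
  have "\<bar>t / r - 1\<bar> = \<bar>t - r\<bar> / r" using assms(1) by (simp add: abs_if field_simps)
  then have "\<bar>t / r - 1\<bar> \<ge> 1 / 2" using assms by (simp add: field_simps)
  then show "bump (t / r) = 0" "bump_deriv (t / r) = 0" using bump_outside by auto
qed

lemma nodal_path_outside:
  assumes "r > 0" "\<bar>t - r\<bar> \<ge> r / 2"
  shows "nodal_path r p v t = 0"
  using assms by (simp add: nodal_path_def bump_rescaled_outside)

lemma smooth_on_nodal_path:
  assumes "open S" "\<And>t. t \<in> S \<Longrightarrow> f t = nodal_path r p v t"
  shows "smooth_on f S"
proof (rule smooth_on_flat_algebra_combination[OF assms(1)])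
  let ?w = "\<lambda>t. 1 + (- 4) * ((t * (1 / r) + (- 1)) * (t * (1 / r) + (- 1)))"
  show *: "(\<lambda>t. exp 1 * flat_exp 1 (?w t)) \<in> flat_algebra"
    by (intro flat_algebra.intros)
  then show "(\<lambda>t. (exp 1 * flat_exp 1 (?w t)) * (t + (- r))) \<in> flat_algebra"
    by (intro flat_algebra.intros)
  have "bump (t / r) = exp 1 * flat_exp 1 (?w t)" for t
    by (simp add: bump_def power2_eq_square)
  then show "f t = (exp 1 * flat_exp 1 (?w t)) *\<^sub>R p +
      ((exp 1 * flat_exp 1 (?w t)) * (t + (- r))) *\<^sub>R v" if "t \<in> S" for t
    using assms(2)[OF that] by (simp only: nodal_path_def) (simp add: scaleR_right_distrib)
qed

lemma norm_line_le:
  assumes "norm p = r" "norm v = 1" "\<bar>t - r\<bar> \<le> r / 2"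
  shows "norm (p + (t - r) *\<^sub>R v) \<le> 3 / 2 * r"
  using norm_triangle_ineq[of p "(t - r) *\<^sub>R v"] assms by simp

text \<open>On the support of the cutoff, the scale \<open>r\<close> is at most \<open>2 * t\<close>.\<close>

lemma norm_nodal_path_le:
  assumes "r > 0" "norm p = r" "norm v = 1" "t > 0"
  shows "norm (nodal_path r p v t) \<le> 3 * t"
proof (cases "\<bar>t - r\<bar> \<ge> r / 2")
  case True
  then show ?thesis using assms by (simp add: nodal_path_outside)
next
  case False
  have "norm (nodal_path r p v t) \<le> 1 * (3 / 2 * r)"
    unfolding nodal_path_def norm_scaleR
    using False assms bump_bounds[of "t / r"] by (intro mult_mono norm_line_le) auto
  also have "\<dots> \<le> 3 * t" using False by (simp add: abs_if split: if_splits)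
  finally show ?thesis .
qed

text \<open>The bound is uniform in the scale: the derivative of the cutoff grows like \<open>1 / r\<close>, but it
  multiplies a vector of size at most \<open>3 / 2 * r\<close>.\<close>

lemma nodal_path_deriv_bounded:
  obtains K where "K \<ge> 0" "\<And>r (p :: 'a::real_normed_vector) v t.
    r > 0 \<Longrightarrow> norm p = r \<Longrightarrow> norm v = 1 \<Longrightarrow> norm (nodal_path_deriv r p v t) \<le> K"
proof -
  obtain M where M: "M \<ge> 0" "\<And>u. \<bar>bump_deriv u\<bar> \<le> M" using bump_deriv_bounded by blast
  have "norm (nodal_path_deriv r p v t) \<le> M * (3 / 2) + 1"
    if "r > 0" "norm p = r" "norm v = 1" for r t and p v :: 'a
  proof (cases "\<bar>t - r\<bar> \<ge> r / 2")
    case True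
    then show ?thesis using that(1) M(1) by (simp add: nodal_path_deriv_def bump_rescaled_outside)
  next
    case False
    have "norm (nodal_path_deriv r p v t) \<le>
        \<bar>bump_deriv (t / r) / r\<bar> * norm (p + (t - r) *\<^sub>R v) + \<bar>bump (t / r)\<bar> * norm v"
      unfolding nodal_path_deriv_def norm_scaleR[symmetric] by (rule norm_triangle_ineq)
    also have "\<dots> \<le> M / r * (3 / 2 * r) + 1"
      using False that M bump_bounds[of "t / r"]
      by (intro add_mono mult_mono norm_line_le) (auto simp: divide_right_mono)
    finally show ?thesis using that(1) by simp
  qed
  then show ?thesis using that[of "M * (3 / 2) + 1"] M(1) by auto
qed

section \<open>Lacunary sequences\<close>

text \<open>The least \<open>j\<close> such that \<open>u\<close> lies to the right of the interval around \<open>r (Suc j)\<close> works: by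
  minimality \<open>u\<close> is at most \<open>3 / 2 * r j\<close>, so it lies to the left of the interval around the
  preceding term.\<close>

lemma lacunary_neighbourhood:
  fixes r :: "nat \<Rightarrow> real"
  assumes pos: "\<And>j. r j > 0" and quarter: "\<And>j. r (Suc j) \<le> r j / 4"
    and lim: "r \<longlonglongrightarrow> 0" and "u > 0"
  shows "\<exists>j U. open U \<and> u \<in> U \<and> (\<forall>t\<in>U. \<forall>i. i \<noteq> j \<longrightarrow> \<bar>t - r i\<bar> \<ge> r i / 2)"
proof -
  have "r (Suc j) \<le> r j" for j using quarter[of j] pos[of j] by linarith
  then have anti: "r j \<le> r i" if "i \<le> j" for i j
    using that by (rule lift_Suc_antimono_le)
  define P where "P = (\<lambda>j. 3 / 2 * r (Suc j) < u)"
  have "eventually (\<lambda>j. r j < 2 / 3 * u) sequentially"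
    using lim \<open>u > 0\<close> by (intro order_tendstoD(2)) auto
  then obtain N where "r N < 2 / 3 * u" using eventually_happens' sequentially_bot by blast
  then have "P N" using anti[of N "Suc N"] by (simp add: P_def)
  define j where "j = (LEAST j. P j)"
  have j: "3 / 2 * r (Suc j) < u" using LeastI[of P, OF \<open>P N\<close>] by (simp add: P_def j_def)
  define U where "U = {t. 3 / 2 * r (Suc j) < t \<and> (\<forall>i<j. t < r i / 2)}"
  have "U = {3 / 2 * r (Suc j)<..} \<inter> (\<Inter>i\<in>{..<j}. {..<r i / 2})"
    by (auto simp: U_def)
  then have "open U" by (simp add: open_INT open_Int)
  moreover have "u \<in> U"
  proof -
    have "u < r i / 2" if i: "i < j" for i
    proof -
      obtain k where k: "j = Suc k" using i by (cases j) auto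
      then have "\<not> P k" using not_less_Least[of k P] by (simp add: j_def)
      then have "u \<le> 3 / 2 * r j" by (simp add: P_def k)
      also have "\<dots> < r k / 2" using quarter[of k] pos[of k] k by simp
      also have "\<dots> \<le> r i / 2" using anti[of i k] i k by simp
      finally show ?thesis .
    qed
    then show ?thesis using j by (simp add: U_def)
  qed
  moreover have "\<bar>t - r i\<bar> \<ge> r i / 2" if "t \<in> U" "i \<noteq> j" for t i
  proof (cases "i < j")
    case True
    then have "t < r i / 2" using that(1) by (simp add: U_def)
    then show ?thesis by linarith
  next
    case False
    then have "r i \<le> r (Suc j)" using that(2) by (intro anti) simp
    then have "3 / 2 * r i < t" using that(1) by (auto simp: U_def)
    then show ?thesis by linarith
  qed
  ultimately show ?thesis by blast
qed

lemma lacunary_subsequence: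
  fixes x :: "nat \<Rightarrow> 'a::real_normed_vector"
  assumes nz: "\<And>k. k \<ge> 1 \<Longrightarrow> x k \<noteq> 0" and lim: "x \<longlonglongrightarrow> 0"
  obtains f where "strict_mono f" "\<And>j. f j \<ge> 1" "\<And>j. norm (x (f j)) < 1"
    "\<And>j. norm (x (f (Suc j))) \<le> norm (x (f j)) / 4"
proof -
  have small: "\<exists>k>m. norm (x k) < e" if "e > 0" for e m
  proof -
    have "eventually (\<lambda>k. norm (x k) < e \<and> m < k) sequentially"
      using lim that by (intro eventually_conj order_tendstoD(2)[OF tendsto_norm_zero]
          eventually_gt_at_top) auto
    then show ?thesis using eventually_happens' sequentially_bot by blast
  qed
  have "\<exists>f. \<forall>j. (f j \<ge> 1 \<and> norm (x (f j)) < 1) \<and>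
      (f j < f (Suc j) \<and> norm (x (f (Suc j))) \<le> norm (x (f j)) / 4)"
  proof (rule dependent_nat_choice)
    show "\<exists>k\<ge>1. norm (x k) < 1" using small[of 1 0] by (metis One_nat_def Suc_leI zero_less_one)
    fix k :: nat
    assume k: "k \<ge> 1 \<and> norm (x k) < 1"
    then obtain l where "l > k" "norm (x l) < norm (x k) / 4"
      using small[of "norm (x k) / 4" k] nz[of k] by auto
    then show "\<exists>l. (l \<ge> 1 \<and> norm (x l) < 1) \<and> k < l \<and> norm (x l) \<le> norm (x k) / 4"
      using k by (intro exI[of _ l]) auto
  qed
  then show ?thesis using that by (metis strict_mono_Suc_iff)
qed

section \<open>The path\<close>

theorem lemma2:
  fixes x y :: "nat \<Rightarrow> real ^ 'n"
  assumes x_nz: "\<And>k. k \<ge> 1 \<Longrightarrow> x k \<noteq> 0"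
    and y_nz: "\<And>k. k \<ge> 1 \<Longrightarrow> y k \<noteq> 0"
    and x_lim: "x \<longlonglongrightarrow> 0"
    and y_unit: "\<And>k. k \<ge> 1 \<Longrightarrow> norm (y k) = 1"
    and xy_nonneg: "\<And>k. k \<ge> 1 \<Longrightarrow> x k \<bullet> y k \<ge> 0"
  shows "\<exists>(a::real) (s :: real \<Rightarrow> real ^ 'n).
           a > 0 \<and>
           smooth_on s {0<..<a} \<and>
           (s \<longlongrightarrow> 0) (at_right 0) \<and>
           bdd_above ((\<lambda>t. norm (s t) * norm (vector_derivative s (at t))) ` {0<..<a}) \<and>
           infinite {k. k \<ge> 1 \<and> norm (x k) < a \<and> s (norm (x k)) = x k \<and>
                        vector_derivative s (at (norm (x k))) = y k}"
proof -
  obtain f where f: "strict_mono f" and f1: "\<And>j. f j \<ge> 1" and small: "\<And>j. norm (x (f j)) < 1"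
    and quarter: "\<And>j. norm (x (f (Suc j))) \<le> norm (x (f j)) / 4"
    using lacunary_subsequence[OF x_nz x_lim] by blast
  define r where "r = (\<lambda>j. norm (x (f j)))"
  define b where "b = (\<lambda>j. nodal_path (r j) (x (f j)) (y (f j)))"
  define b' where "b' = (\<lambda>j. nodal_path_deriv (r j) (x (f j)) (y (f j)))"
  define s where "s = (\<lambda>t. \<Sum>j. b j t)"
  have pos: "r j > 0" for j using x_nz[OF f1] by (simp add: r_def)
  have unit: "norm (y (f j)) = 1" for j using y_unit[OF f1] .
  have r_lim: "r \<longlonglongrightarrow> 0"
    using tendsto_norm_zero[OF LIMSEQ_subseq_LIMSEQ[OF x_lim f]] by (simp add: r_def o_def)
  \<comment> \<open>At a node \<open>r i\<close> the surviving summand must be the \<open>i\<close>-th one, as \<open>r i\<close> lies in the interior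
    of its support.\<close>
  have single: "\<exists>j U. open U \<and> u \<in> U \<and> (\<forall>t\<in>U. s t = b j t) \<and> (\<forall>i. u = r i \<longrightarrow> j = i)"
    if "u > 0" for u
  proof -
    obtain j U where U: "open U" "u \<in> U"
      and away: "\<And>t i. t \<in> U \<Longrightarrow> i \<noteq> j \<Longrightarrow> \<bar>t - r i\<bar> \<ge> r i / 2"
      using lacunary_neighbourhood[of r u] pos quarter r_lim \<open>u > 0\<close> unfolding r_def by metis
    have "s t = b j t" if "t \<in> U" for t
    proof -
      have "s t = (\<Sum>i\<in>{j}. b i t)"
        unfolding s_def
        by (rule suminf_finite) (auto simp: b_def intro!: nodal_path_outside pos away that)
      then show ?thesis by simp
    qed
    moreover have "j = i" if "u = r i" for i
      using away[OF U(2), of i] that pos[of i] by auto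
    ultimately show ?thesis using U by blast
  qed
  have deriv: "vector_derivative s (at u) = b' j u"
    if "open U" "u \<in> U" "\<And>t. t \<in> U \<Longrightarrow> s t = b j t" for u j U
  proof (rule vector_derivative_at)
    show "(s has_vector_derivative b' j u) (at u)"
      using that has_vector_derivative_transform_within_open[of "b j" "b' j u" u U s]
        has_vector_derivative_nodal_path[of "r j" "x (f j)" "y (f j)" u]
      by (simp add: b_def b'_def)
  qed
  have smooth: "smooth_on s {0<..<1}"
  proof (rule smooth_on_if_locally_smooth)
    fix t :: real assume "t \<in> {0<..<1}"
    then obtain j U where "open U" "t \<in> U" "\<forall>t\<in>U. s t = b j t" using single[of t] by auto
    then show "\<exists>U. t \<in> U \<and> smooth_on s U"
      using smooth_on_nodal_path[of U s] unfolding b_def by blast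
  qed
  have s_le: "norm (s t) \<le> 3 * t" if t: "t > 0" for t
  proof -
    obtain j where "s t = b j t" using single[OF t] by blast
    then show ?thesis
      using norm_nodal_path_le[OF pos _ unit t] by (simp add: b_def r_def)
  qed
  have s_lim: "(s \<longlongrightarrow> 0) (at_right 0)"
  proof (rule Lim_null_comparison)
    show "eventually (\<lambda>t. norm (s t) \<le> 3 * t) (at_right 0)"
      using s_le by (auto intro: eventually_mono[OF eventually_at_right_less])
    show "((\<lambda>t. 3 * t) \<longlongrightarrow> 0) (at_right (0::real))"
      by (auto intro!: tendsto_eq_intros)
  qed
  obtain K where K: "K \<ge> 0" "\<And>r (p :: real ^ 'n) v t.
    r > 0 \<Longrightarrow> norm p = r \<Longrightarrow> norm v = 1 \<Longrightarrow> norm (nodal_path_deriv r p v t) \<le> K"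
    using nodal_path_deriv_bounded by blast
  have "norm (s t) * norm (vector_derivative s (at t)) \<le> 3 * K" if t: "t \<in> {0<..<1}" for t
  proof (rule mult_mono)
    show "norm (s t) \<le> 3" using s_le[of t] t by simp
    obtain j where "vector_derivative s (at t) = b' j t" using single[of t] deriv t by auto
    then show "norm (vector_derivative s (at t)) \<le> K"
      using K(2)[OF pos _ unit] by (simp add: b'_def r_def)
  qed auto
  then have bdd: "bdd_above ((\<lambda>t. norm (s t) * norm (vector_derivative s (at t))) ` {0<..<1})"
    by (intro bdd_aboveI2[where M = "3 * K"]) auto
  have node: "s (r j) = x (f j) \<and> vector_derivative s (at (r j)) = y (f j)" for j
  proof -
    obtain U where U: "open U" "r j \<in> U" "\<forall>t\<in>U. s t = b j t" using single[OF pos] by metis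
    then have "s (r j) = b j (r j)" "vector_derivative s (at (r j)) = b' j (r j)"
      using deriv by auto
    then show ?thesis using pos[of j] by (simp add: b_def b'_def nodal_path_at_node)
  qed
  have "range f \<subseteq> {k. k \<ge> 1 \<and> norm (x k) < 1 \<and> s (norm (x k)) = x k \<and>
      vector_derivative s (at (norm (x k))) = y k}"
    using f1 small node by (auto simp: r_def)
  moreover have "infinite (range f)"
    using f by (simp add: range_inj_infinite strict_mono_imp_inj_on)
  ultimately have "infinite {k. k \<ge> 1 \<and> norm (x k) < 1 \<and> s (norm (x k)) = x k \<and>
      vector_derivative s (at (norm (x k))) = y k}"
    using infinite_super by blast
  then show ?thesis
    using smooth s_lim bdd by (intro exI[of _ 1] exI[of _ s]) auto
qed

end
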